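(* For every $\ell\ge1$ the second kind functions are Schur complements (equivalently, last quasi-determinants) of bordered truncated moment matrices: $$C_{[\ell]}=\operatorname{SC}\left(\begin{array}{ccc|c} G_{[0],[0]}&\cdots&G_{[0],[\ell-1]}&\Gamma_{[0]}\\ \vdots&&\vdots&\vdots\\ G_{[\ell-1],[0]}&\cdots&G_{[\ell-1],[\ell-1]}&\Gamma_{[\ell-1]}\\ \hline G_{[\ell],[0]}&\cdots&G_{[\ell],[\ell-1]}&\Gamma_{[\ell]}\end{array}\right)=\Theta_*\begin{pmatrix} G_{[0],[0]}&\cdots&G_{[0],[\ell-1]}&\Gamma_{[0]}\\ \vdots&&\vdots&\vdots\\ G_{[\ell-1],[0]}&\cdots&G_{[\ell-1],[\ell-1]}&\Gamma_{[\ell-1]}\\ G_{[\ell],[0]}&\cdots&G_{[\ell],[\ell-1]}&\Gamma_{[\ell]}\end{pmatrix}.$$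
   Context: Let $D\ge 1$ and let $\mu$ be a Borel measure on $\Omega\subseteq\mathbb R^D$ with finite moments. For $k\in\mathbb Z_+$ let $[k]=\{\alpha\in\mathbb Z_+^D:|\alpha|=k\}$, ordered so that $\alpha>\alpha'$ iff at the first coordinate where they differ the entry of $\alpha$ is smaller. $\chi_{[k]}(x)$ is the column vector of monomials $x^\alpha$, $\alpha\in[k]$, in this order, and $\chi$ stacks $\chi_{[0]},\chi_{[1]},\dots$. Put $\chi^*(x)=\big(\prod_{a=1}^Dx_a^{-1}\big)\chi(x_1^{-1},\dots,x_D^{-1})$. Semi-infinite matrices are partitioned in blocks $A_{[k],[\ell]}\in\mathbb R^{|[k]|\times|[\ell]|}$; $A^{[\ell]}$ is the truncation to the first $\ell$ block rows and columns (indices $0,\dots,\ell-1$). The moment matrix is $G=\int_\Omega\chi\,d\mu\,\chi^\top$. Standing assumption: $\det G^{[\ell]}\ne0$ for all $\ell$, so that $G=S^{-1}H(S^{-1})^\top$ with $S$ block lower triangular with identity diagonal blocks and $H=\operatorname{diag}(H_{[0]},H_{[1]},\dots)$. The second kind functions are the blocks $C_{[\ell]}$ of $C=H(S^{-1})^\top\chi^*$ (multiple Laurent series in $x$, in negative powers), and $\Gamma_{[k]}$ are the blocks of $\Gamma=G\chi^*$, i.e. $\Gamma_{[k]}=\sum_{n\ge0}G_{[k],[n]}\chi^*_{[n]}$ (also Laurent series). For a block matrix with $A$ square invertible, $\operatorname{SC}\left(\begin{array}{c|c}A&B\\ \hline C&E\end{array}\right)=E-CA^{-1}B$. The last quasi-determinant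 $\Theta_*$ of a partitioned matrix is this Schur complement, where $E$ is the lower right corner block and $A$ consists of all block rows and columns except the last ones. *)

theory Defs
  imports
    "HOL-Analysis.Analysis"
    "HOL-Library.Groups_Big_Fun"
    "Jordan_Normal_Form.Determinant"
begin

text \<open>
  Both \<^theory>\<open>HOL-Analysis.Finite_Cartesian_Product\<close> and
  \<^theory>\<open>Jordan_Normal_Form.Matrix\<close> use the dollar sign for vector components. Here it always
  means \<^const>\<open>vec_nth\<close>; matrices of varying size are those of
  \<^theory>\<open>Jordan_Normal_Form.Matrix\<close>.
\<close>

no_notation Matrix.vec_index (infixl "$" 100)

section \<open>Multi-indices\<close>

text \<open>
  The coordinates \<open>1, \<dots>, D\<close> are the elements of a finite linearly ordered type \<open>'n\<close>, so
  \<open>D = CARD('n) \<ge> 1\<close>, and \<open>\<real>\<^sup>D\<close> and \<open>\<int>\<^sub>+\<^sup>D\<close> are \<^typ>\<open>real ^ 'n\<close> and \<^typ>\<open>nat ^ 'n\<close>.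
\<close>

type_synonym 'n point = "real ^ 'n"

type_synonym 'n multi_index = "nat ^ 'n"

definition mi_size :: "'n::finite multi_index \<Rightarrow> nat" where
  "mi_size \<alpha> = (\<Sum>a\<in>UNIV. \<alpha> $ a)"

definition mi_less :: "'n::{finite,linorder} multi_index \<Rightarrow> 'n multi_index \<Rightarrow> bool" where
  "mi_less \<alpha>' \<alpha> \<longleftrightarrow> (\<exists>a. (\<forall>b<a. \<alpha> $ b = \<alpha>' $ b) \<and> \<alpha> $ a < \<alpha>' $ a)"

text \<open>The set \<open>[k]\<close>, listed in increasing order; for \<open>k = 1\<close> these are \<open>e\<^sub>1, \<dots>, e\<^sub>D\<close>.\<close>

definition mi_list :: "nat \<Rightarrow> 'n::{finite,linorder} multi_index list" where
  "mi_list k = (THE xs. sorted_wrt mi_less xs \<and> set xs = {\<alpha>. mi_size \<alpha> = k})"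

lemma finite_mi_size: "finite {\<alpha> :: 'n::finite multi_index. mi_size \<alpha> = k}"
proof (rule finite_subset)
  show "{\<alpha> :: 'n multi_index. mi_size \<alpha> = k} \<subseteq> vec_lambda ` (Pi\<^sub>E UNIV (\<lambda>_. {..k}))"
  proof
    fix \<alpha> :: "'n multi_index" assume "\<alpha> \<in> {\<alpha>. mi_size \<alpha> = k}"
    then have k: "(\<Sum>a\<in>UNIV. \<alpha> $ a) = k" by (simp add: mi_size_def)
    have "\<alpha> $ a \<le> k" for a
      using member_le_sum[of a UNIV "\<lambda>a. \<alpha> $ a"] k by simp
    then have "vec_nth \<alpha> \<in> Pi\<^sub>E UNIV (\<lambda>_. {..k})" by (auto simp: PiE_UNIV_domain)
    moreover have "\<alpha> = vec_lambda (vec_nth \<alpha>)" by simp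
    ultimately show "\<alpha> \<in> vec_lambda ` (Pi\<^sub>E UNIV (\<lambda>_. {..k}))" by blast
  qed
  show "finite (vec_lambda ` (Pi\<^sub>E UNIV (\<lambda>_. {..k})) :: 'n multi_index set)"
    by (intro finite_imageI finite_PiE) auto
qed

lemma mi_less_linear:
  fixes \<alpha> \<beta> :: "'n::{finite,linorder} multi_index"
  assumes "\<alpha> \<noteq> \<beta>"
  shows "mi_less \<alpha> \<beta> \<or> mi_less \<beta> \<alpha>"
proof -
  let ?D = "{a. \<alpha> $ a \<noteq> \<beta> $ a}"
  have ne: "?D \<noteq> {}" using assms by (auto simp: Finite_Cartesian_Product.vec_eq_iff)
  have m: "Min ?D \<in> ?D" using Min_in[OF _ ne] by simp
  have "\<alpha> $ b = \<beta> $ b" if "b < Min ?D" for b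
  proof (rule ccontr)
    assume "\<alpha> $ b \<noteq> \<beta> $ b"
    then have "Min ?D \<le> b" by (intro Min_le) auto
    then show False using that by simp
  qed
  then show ?thesis using m unfolding mi_less_def
    by (metis (mono_tags, lifting) linorder_neqE_nat mem_Collect_eq)
qed

lemma mi_less_asym:
  fixes \<alpha> \<beta> :: "'n::{finite,linorder} multi_index"
  assumes "mi_less \<alpha> \<beta>"
  shows "\<not> mi_less \<beta> \<alpha>"
  using assms unfolding mi_less_def
  by (metis less_asym' linorder_neqE less_irrefl_nat)

lemma mi_less_trans:
  fixes \<alpha> \<beta> \<gamma> :: "'n::{finite,linorder} multi_index"
  assumes "mi_less \<alpha> \<beta>" "mi_less \<beta> \<gamma>"
  shows "mi_less \<alpha> \<gamma>"
proof -
  obtain a where a: "\<forall>b<a. \<beta> $ b = \<alpha> $ b" "\<beta> $ a < \<alpha> $ a"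
    using assms(1) by (auto simp: mi_less_def)
  obtain c where c: "\<forall>b<c. \<gamma> $ b = \<beta> $ b" "\<gamma> $ c < \<beta> $ c"
    using assms(2) by (auto simp: mi_less_def)
  have "\<forall>b<min a c. \<gamma> $ b = \<alpha> $ b" using a c by simp
  moreover have "\<gamma> $ min a c < \<alpha> $ min a c"
    using a c by (cases a c rule: linorder_cases) (auto simp: min_def)
  ultimately show ?thesis unfolding mi_less_def by blast
qed

lemma mi_list_ex1:
  "\<exists>!xs :: 'n::{finite,linorder} multi_index list.
     sorted_wrt mi_less xs \<and> set xs = {\<alpha>. mi_size \<alpha> = k}"
proof -
  interpret mi: linorder "\<lambda>\<alpha> \<beta> :: 'n multi_index. \<alpha> = \<beta> \<or> mi_less \<alpha> \<beta>" mi_less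
  proof (unfold_locales, goal_cases)
    case (1 x y) then show ?case using mi_less_asym by blast
  next
    case (2 x) then show ?case by simp
  next
    case (3 x y z) then show ?case using mi_less_trans by blast
  next
    case (4 x y) then show ?case using mi_less_asym by blast
  next
    case (5 x y) then show ?case using mi_less_linear by blast
  qed
  obtain xs where "mi.sorted xs" "set xs = {\<alpha>. mi_size \<alpha> = k}" "distinct xs"
    using mi.finite_sorted_distinct_unique[OF finite_mi_size[of k]] by auto
  then show ?thesis
    using mi.strict_sorted_iff mi.strict_sorted_equal by (intro ex1I[of _ xs]) auto
qed

lemma mi_list_sorted: "sorted_wrt mi_less (mi_list k)"
  and set_mi_list: "set (mi_list k) = {\<alpha>. mi_size \<alpha> = k}"
  using theI'[OF mi_list_ex1[of k]] unfolding mi_list_def by auto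

section \<open>Laurent series in negative powers\<close>

text \<open>
  Formal series \<open>\<Sum>\<^sub>\<alpha> c\<^sub>\<alpha> x\<^sup>-\<^sup>\<alpha>\<close> with \<open>\<alpha>\<close> ranging over \<open>\<int>\<^sub>+\<^sup>D\<close>, that is, the multiple Laurent
  series in which no variable occurs with a positive exponent; \<open>nl_coeff f \<alpha>\<close> is the
  coefficient of \<open>x\<^sup>-\<^sup>\<alpha>\<close>. They form a ring under the Cauchy product, into which \<open>\<real>\<close> embeds.
\<close>

typedef 'n neg_laurent = "UNIV :: ('n::finite multi_index \<Rightarrow> real) set"
  morphisms nl_coeff Neg_Laurent ..

lemma nl_coeff_Neg_Laurent [simp]: "nl_coeff (Neg_Laurent c) = c"
  by (simp add: Neg_Laurent_inverse)

lemma neg_laurent_eqI: "(\<And>\<alpha>. nl_coeff f \<alpha> = nl_coeff g \<alpha>) \<Longrightarrow> f = g"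
  by (metis nl_coeff_inject ext)

definition mi_splits :: "'n::finite multi_index \<Rightarrow> ('n multi_index \<times> 'n multi_index) set" where
  "mi_splits \<alpha> = {(\<beta>, \<gamma>). \<beta> + \<gamma> = \<alpha>}"

lemma finite_mi_splits [simp]: "finite (mi_splits \<alpha>)"
proof (rule finite_subset)
  let ?B = "\<Union>j\<le>mi_size \<alpha>. {\<beta> :: 'a multi_index. mi_size \<beta> = j}"
  show "mi_splits \<alpha> \<subseteq> ?B \<times> ?B"
    by (auto simp: mi_splits_def mi_size_def sum.distrib)
  show "finite (?B \<times> ?B)" by (simp add: finite_mi_size)
qed

lemma mi_splits_0: "mi_splits 0 = {(0, 0)}"
  by (auto simp: mi_splits_def Finite_Cartesian_Product.vec_eq_iff)

instantiation neg_laurent :: (finite) comm_ring_1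
begin

definition zero_neg_laurent :: "'a neg_laurent" where
  "0 = Neg_Laurent (\<lambda>_. 0)"

definition one_neg_laurent :: "'a neg_laurent" where
  "1 = Neg_Laurent (\<lambda>\<alpha>. if \<alpha> = 0 then 1 else 0)"

definition plus_neg_laurent :: "'a neg_laurent \<Rightarrow> 'a neg_laurent \<Rightarrow> 'a neg_laurent" where
  "f + g = Neg_Laurent (\<lambda>\<alpha>. nl_coeff f \<alpha> + nl_coeff g \<alpha>)"

definition minus_neg_laurent :: "'a neg_laurent \<Rightarrow> 'a neg_laurent \<Rightarrow> 'a neg_laurent" where
  "f - g = Neg_Laurent (\<lambda>\<alpha>. nl_coeff f \<alpha> - nl_coeff g \<alpha>)"

definition uminus_neg_laurent :: "'a neg_laurent \<Rightarrow> 'a neg_laurent" where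
  "- f = Neg_Laurent (\<lambda>\<alpha>. - nl_coeff f \<alpha>)"

definition times_neg_laurent :: "'a neg_laurent \<Rightarrow> 'a neg_laurent \<Rightarrow> 'a neg_laurent" where
  "f * g = Neg_Laurent (\<lambda>\<alpha>. \<Sum>(\<beta>, \<gamma>)\<in>mi_splits \<alpha>. nl_coeff f \<beta> * nl_coeff g \<gamma>)"

instance
proof
  fix f g h :: "'a neg_laurent"
  show "f * g * h = f * (g * h)"
  proof (rule neg_laurent_eqI)
    fix \<alpha> :: "'a multi_index"
    have "nl_coeff (f * g * h) \<alpha>
      = (\<Sum>p\<in>mi_splits \<alpha>. \<Sum>q\<in>mi_splits (fst p).
          nl_coeff f (fst q) * nl_coeff g (snd q) * nl_coeff h (snd p))"
      by (simp add: times_neg_laurent_def sum_distrib_right case_prod_beta)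
    also have "\<dots> = (\<Sum>(p, q)\<in>Sigma (mi_splits \<alpha>) (\<lambda>p. mi_splits (fst p)).
          nl_coeff f (fst q) * nl_coeff g (snd q) * nl_coeff h (snd p))"
      by (rule sum.Sigma) auto
    also have "\<dots> = (\<Sum>(p, q)\<in>Sigma (mi_splits \<alpha>) (\<lambda>p. mi_splits (snd p)).
          nl_coeff f (fst p) * (nl_coeff g (fst q) * nl_coeff h (snd q)))"
      by (rule sum.reindex_bij_witness
          [where i = "\<lambda>(p, q). ((fst p + fst q, snd q), (fst p, fst q))"
             and j = "\<lambda>(p, q). ((fst q, snd q + snd p), (snd q, snd p))"])
        (auto simp: mi_splits_def add.assoc mult.assoc)
    also have "\<dots> = (\<Sum>p\<in>mi_splits \<alpha>. \<Sum>q\<in>mi_splits (snd p).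
          nl_coeff f (fst p) * (nl_coeff g (fst q) * nl_coeff h (snd q)))"
      by (rule sum.Sigma [symmetric]) auto
    also have "\<dots> = nl_coeff (f * (g * h)) \<alpha>"
      by (simp add: times_neg_laurent_def sum_distrib_left case_prod_beta)
    finally show "nl_coeff (f * g * h) \<alpha> = nl_coeff (f * (g * h)) \<alpha>" .
  qed
  show "f * g = g * f"
  proof (rule neg_laurent_eqI)
    fix \<alpha> :: "'a multi_index"
    show "nl_coeff (f * g) \<alpha> = nl_coeff (g * f) \<alpha>"
      unfolding times_neg_laurent_def nl_coeff_Neg_Laurent
      by (rule sum.reindex_bij_witness[where i = prod.swap and j = prod.swap])
        (auto simp: mi_splits_def add.commute mult.commute)
  qed
  show "1 * f = f"
  proof (rule neg_laurent_eqI)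
    fix \<alpha> :: "'a multi_index"
    have "nl_coeff (1 * f) \<alpha>
      = (\<Sum>p\<in>mi_splits \<alpha>. if p = (0, \<alpha>) then nl_coeff f \<alpha> else 0)"
      unfolding times_neg_laurent_def one_neg_laurent_def nl_coeff_Neg_Laurent
      by (rule sum.cong) (auto simp: mi_splits_def split: if_splits)
    also have "\<dots> = (if (0, \<alpha>) \<in> mi_splits \<alpha> then nl_coeff f \<alpha> else 0)"
      by (rule sum.delta) simp
    also have "\<dots> = nl_coeff f \<alpha>" by (simp add: mi_splits_def)
    finally show "nl_coeff (1 * f) \<alpha> = nl_coeff f \<alpha>" .
  qed
  show "(f + g) * h = f * h + g * h"
    by (rule neg_laurent_eqI)
      (simp add: times_neg_laurent_def plus_neg_laurent_def case_prod_beta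
        distrib_right sum.distrib)
  show "f + g + h = f + (g + h)" "f + g = g + f" "0 + f = f" "- f + f = 0" "f - g = f + - g"
    by (rule neg_laurent_eqI; simp add: plus_neg_laurent_def minus_neg_laurent_def
        uminus_neg_laurent_def zero_neg_laurent_def)+
  have "nl_coeff (0 :: 'a neg_laurent) 0 \<noteq> nl_coeff 1 0"
    by (simp add: zero_neg_laurent_def one_neg_laurent_def)
  then show "(0 :: 'a neg_laurent) \<noteq> 1" by auto
qed

end

definition const :: "real \<Rightarrow> 'n::finite neg_laurent" where
  "const c = Neg_Laurent (\<lambda>\<alpha>. if \<alpha> = 0 then c else 0)"

text \<open>The monomial \<open>x\<^sub>a\<^sup>-\<^sup>1\<close>.\<close>

definition X_inv :: "'n::finite \<Rightarrow> 'n neg_laurent" where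
  "X_inv a = Neg_Laurent (\<lambda>\<alpha>. if \<alpha> = axis a 1 then 1 else 0)"

text \<open>
  Infinite sums of series are formed coefficientwise. This is meant for families in which every
  power of \<open>x\<close> occurs in only finitely many members; \<^const>\<open>Sum_any\<close> adds the nonzero terms.
\<close>

definition formal_sum :: "('i \<Rightarrow> 'n::finite neg_laurent) \<Rightarrow> 'n neg_laurent" where
  "formal_sum f = Neg_Laurent (\<lambda>\<alpha>. Sum_any (\<lambda>i. nl_coeff (f i) \<alpha>))"

section \<open>Semi-infinite matrices\<close>

text \<open>
  Rows and columns of a semi-infinite matrix are indexed by all multi-indices. Only products in
  which each entry is a finite sum are used.
\<close>

type_synonym 'n simat = "'n multi_index \<Rightarrow> 'n multi_index \<Rightarrow> real"

definition simat_mult :: "'n::finite simat \<Rightarrow> 'n simat \<Rightarrow> 'n simat" (infixl "**\<^sub>s" 70) where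
  "A **\<^sub>s B = (\<lambda>\<alpha> \<beta>. Sum_any (\<lambda>\<gamma>. A \<alpha> \<gamma> * B \<gamma> \<beta>))"

definition simat_one :: "'n::finite simat" where
  "simat_one = (\<lambda>\<alpha> \<beta>. if \<alpha> = \<beta> then 1 else 0)"

definition simat_transpose :: "'n::finite simat \<Rightarrow> 'n simat" where
  "simat_transpose A = (\<lambda>\<alpha> \<beta>. A \<beta> \<alpha>)"

definition simat_inv :: "'n::finite simat \<Rightarrow> 'n simat" where
  "simat_inv A = (THE B. A **\<^sub>s B = simat_one \<and> B **\<^sub>s A = simat_one)"

definition simat_apply ::
    "'n::finite simat \<Rightarrow> ('n multi_index \<Rightarrow> 'n neg_laurent) \<Rightarrow> ('n multi_index \<Rightarrow> 'n neg_laurent)" where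
  "simat_apply A v = (\<lambda>\<alpha>. formal_sum (\<lambda>\<gamma>. const (A \<alpha> \<gamma>) * v \<gamma>))"

definition block :: "'n::{finite,linorder} simat \<Rightarrow> nat \<Rightarrow> nat \<Rightarrow> real mat" where
  "block A k l = Matrix.mat (length (mi_list k :: 'n multi_index list))
     (length (mi_list l :: 'n multi_index list)) (\<lambda>(i, j). A (mi_list k ! i) (mi_list l ! j))"

definition vblock ::
    "('n::{finite,linorder} multi_index \<Rightarrow> 'n neg_laurent) \<Rightarrow> nat \<Rightarrow> 'n neg_laurent mat" where
  "vblock v k = Matrix.mat (length (mi_list k :: 'n multi_index list)) 1 (\<lambda>(i, _). v (mi_list k ! i))"

section \<open>Partitioned matrices, Schur complements and quasi-determinants\<close>

definition append_cols :: "'a::zero mat \<Rightarrow> 'a mat \<Rightarrow> 'a mat" where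
  "append_cols A B = four_block_mat A B (0\<^sub>m 0 (dim_col A)) (0\<^sub>m 0 (dim_col B))"

text \<open>A partitioned matrix is given as the list of its block rows.\<close>

definition block_mat :: "'a::zero mat list list \<Rightarrow> 'a mat" where
  "block_mat R =
     foldr append_rows (map (\<lambda>r. foldr append_cols r (0\<^sub>m 0 0)) R) (0\<^sub>m 0 0)"

definition mat_inv :: "'a::comm_ring_1 mat \<Rightarrow> 'a mat" where
  "mat_inv A = (THE B. inverts_mat A B \<and> inverts_mat B A)"

definition SC :: "'a::comm_ring_1 mat \<Rightarrow> 'a mat \<Rightarrow> 'a mat \<Rightarrow> 'a mat \<Rightarrow> 'a mat" where
  "SC A B C E = E - C * mat_inv A * B"

definition last_quasidet :: "'a::comm_ring_1 mat list list \<Rightarrow> 'a mat" where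
  "last_quasidet R =
     SC (block_mat (map butlast (butlast R))) (block_mat (map (\<lambda>r. [last r]) (butlast R)))
        (block_mat [butlast (last R)])        (last (last R))"

definition truncation :: "'n::{finite,linorder} simat \<Rightarrow> nat \<Rightarrow> real mat" where
  "truncation A l = block_mat (map (\<lambda>i. map (block A i) [0..<l]) [0..<l])"

section \<open>Moments and second kind functions\<close>

definition chi :: "('n::finite \<Rightarrow> 'a::comm_monoid_mult) \<Rightarrow> 'n multi_index \<Rightarrow> 'a" where
  "chi y \<alpha> = (\<Prod>a\<in>UNIV. y a ^ (\<alpha> $ a))"

definition chi_star :: "'n::finite multi_index \<Rightarrow> 'n neg_laurent" where
  "chi_star \<alpha> = (\<Prod>a\<in>UNIV. X_inv a) * chi X_inv \<alpha>"

definition borel_measure_on :: "'n::finite point set \<Rightarrow> 'n point measure \<Rightarrow> bool" where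
  "borel_measure_on \<Omega> \<mu> \<longleftrightarrow> sets \<mu> = sets (restrict_space borel \<Omega>)"

definition finite_moments :: "'n::finite point measure \<Rightarrow> bool" where
  "finite_moments \<mu> \<longleftrightarrow> (\<forall>\<alpha>. integrable \<mu> (\<lambda>x. chi (vec_nth x) \<alpha>))"

definition moment_matrix :: "'n::finite point measure \<Rightarrow> 'n simat" where
  "moment_matrix \<mu> = (\<lambda>\<alpha> \<beta>. \<integral>x. chi (vec_nth x) \<alpha> * chi (vec_nth x) \<beta> \<partial>\<mu>)"

definition block_unitriangular :: "'n::{finite,linorder} simat \<Rightarrow> bool" where
  "block_unitriangular S \<longleftrightarrow>
     (\<forall>k l. k < l \<longrightarrow> block S k l = 0\<^sub>m (dim_row (block S k l)) (dim_col (block S k l))) \<and>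
     (\<forall>k. block S k k = 1\<^sub>m (dim_row (block S k k)))"

definition block_diagonal :: "'n::{finite,linorder} simat \<Rightarrow> bool" where
  "block_diagonal H \<longleftrightarrow>
     (\<forall>k l. k \<noteq> l \<longrightarrow> block H k l = 0\<^sub>m (dim_row (block H k l)) (dim_col (block H k l)))"

text \<open>
  The Cholesky (block Gauss--Borel) factorization \<open>G = S\<^sup>-\<^sup>1 H (S\<^sup>-\<^sup>1)\<^sup>T\<close>. If all
  truncations of the symmetric matrix \<open>G\<close> are nonsingular, it exists and determines \<open>S\<close> and \<open>H\<close>.
\<close>

definition cholesky ::
    "'n::{finite,linorder} simat \<Rightarrow> 'n simat \<Rightarrow> 'n simat \<Rightarrow> bool" where
  "cholesky G S H \<longleftrightarrow> block_unitriangular S \<and> block_diagonal H \<and>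
     G = simat_inv S **\<^sub>s H **\<^sub>s simat_transpose (simat_inv S)"

definition second_kind ::
    "'n::finite simat \<Rightarrow> 'n simat \<Rightarrow> 'n multi_index \<Rightarrow> 'n neg_laurent" where
  "second_kind S H = simat_apply (H **\<^sub>s simat_transpose (simat_inv S)) chi_star"

definition Gamma_vec :: "'n::finite point measure \<Rightarrow> 'n multi_index \<Rightarrow> 'n neg_laurent" where
  "Gamma_vec \<mu> = simat_apply (moment_matrix \<mu>) chi_star"

text \<open>The blocks of the moment matrix, with entries regarded as constant series.\<close>

definition G_block ::
    "'n::{finite,linorder} point measure \<Rightarrow> nat \<Rightarrow> nat \<Rightarrow> 'n neg_laurent mat" where
  "G_block \<mu> k l = map_mat const (block (moment_matrix \<mu>) k l)"

definition Gamma_block ::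
    "'n::{finite,linorder} point measure \<Rightarrow> nat \<Rightarrow> 'n neg_laurent mat" where
  "Gamma_block \<mu> k = vblock (Gamma_vec \<mu>) k"

end

theory Submission
  imports Defs
begin

text \<open>
  With \<open>T = S\<^sup>-\<^sup>1\<close> and \<open>M = H T\<^sup>T\<close>, the factorization reads \<open>G = T M\<close>, so \<open>M = S G\<close>. As \<open>S\<close> is block
  lower unitriangular and \<open>M\<close> is block upper triangular, block row \<open>\<ell>\<close> of this identity gives
  \<open>G\<^bsub>[\<ell>],<\<ell>\<^esub> = - S\<^bsub>[\<ell>],<\<ell>\<^esub> G\<^bsup>[\<ell>]\<^esup>\<close> in the columns before \<open>\<ell>\<close>, and applied to \<open>\<chi>\<^sup>*\<close> it gives
  \<open>C\<^bsub>[\<ell>]\<^esub> = \<Gamma>\<^bsub>[\<ell>]\<^esub> + S\<^bsub>[\<ell>],<\<ell>\<^esub> \<Gamma>\<^bsub><\<ell>\<^esub>\<close>. Eliminating \<open>S\<^bsub>[\<ell>],<\<ell>\<^esub>\<close> yields the Schur complement.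
\<close>

section \<open>Monomials in negative powers\<close>

definition nl_monom :: "'n::finite multi_index \<Rightarrow> 'n neg_laurent" where
  "nl_monom \<delta> = Neg_Laurent (\<lambda>\<alpha>. if \<alpha> = \<delta> then 1 else 0)"

lemma nl_coeff_plus [simp]: "nl_coeff (f + g) \<alpha> = nl_coeff f \<alpha> + nl_coeff g \<alpha>"
  by (simp add: plus_neg_laurent_def)

lemma nl_coeff_zero [simp]: "nl_coeff 0 \<alpha> = 0"
  by (simp add: zero_neg_laurent_def)

lemma nl_coeff_sum: "nl_coeff (sum f A) \<alpha> = (\<Sum>i\<in>A. nl_coeff (f i) \<alpha>)"
  by (induction A rule: infinite_finite_induct) auto

lemma nl_coeff_const_mult [simp]: "nl_coeff (const c * f) \<alpha> = c * nl_coeff f \<alpha>"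
proof -
  have "nl_coeff (const c * f) \<alpha>
      = (\<Sum>p\<in>mi_splits \<alpha>. if p = (0, \<alpha>) then c * nl_coeff f \<alpha> else 0)"
    unfolding times_neg_laurent_def const_def nl_coeff_Neg_Laurent
    by (rule sum.cong) (auto simp: mi_splits_def split: if_splits)
  also have "\<dots> = c * nl_coeff f \<alpha>"
    by (simp only: sum.delta[OF finite_mi_splits]) (simp add: mi_splits_def)
  finally show ?thesis .
qed

lemma nl_monom_mult: "nl_monom \<beta> * nl_monom \<gamma> = nl_monom (\<beta> + \<gamma>)"
proof (rule neg_laurent_eqI)
  fix \<alpha> :: "'a multi_index"
  have "nl_coeff (nl_monom \<beta> * nl_monom \<gamma>) \<alpha>
      = (\<Sum>p\<in>mi_splits \<alpha>. if p = (\<beta>, \<gamma>) then 1 else 0)"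
    unfolding times_neg_laurent_def nl_monom_def nl_coeff_Neg_Laurent
    by (rule sum.cong) (auto split: if_splits)
  also have "\<dots> = nl_coeff (nl_monom (\<beta> + \<gamma>)) \<alpha>"
    by (simp only: sum.delta[OF finite_mi_splits]) (auto simp: mi_splits_def nl_monom_def)
  finally show "nl_coeff (nl_monom \<beta> * nl_monom \<gamma>) \<alpha> = nl_coeff (nl_monom (\<beta> + \<gamma>)) \<alpha>" .
qed

lemma nl_monom_0: "nl_monom 0 = 1"
  by (simp add: nl_monom_def one_neg_laurent_def)

lemma nl_monom_sum: "(\<Prod>a\<in>A. nl_monom (g a)) = nl_monom (\<Sum>a\<in>A. g a)"
  by (induction A rule: infinite_finite_induct) (auto simp: nl_monom_0 nl_monom_mult)

lemma X_inv_power: "X_inv a ^ k = nl_monom (axis a k)"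
proof (induction k)
  case 0
  have "axis a 0 = (0 :: 'a multi_index)"
    by (simp add: Finite_Cartesian_Product.vec_eq_iff axis_def)
  then show ?case by (simp only: power_0 nl_monom_0)
next
  case (Suc k)
  have "axis a (1 :: nat) + axis a k = (axis a (Suc k) :: 'a multi_index)"
    by (simp add: Finite_Cartesian_Product.vec_eq_iff axis_def)
  moreover have "X_inv a = nl_monom (axis a 1)"
    by (simp add: X_inv_def nl_monom_def)
  ultimately show ?case by (metis Suc power_Suc nl_monom_mult)
qed

text \<open>The prefactor of \<open>chi_star\<close> raises every exponent by one; distinct \<alpha>
  still give distinct monomials.\<close>

lemma chi_star_monom: "chi_star \<alpha> = nl_monom (\<chi> a. Suc (\<alpha> $ a))"
proof -
  have "chi_star \<alpha> = (\<Prod>a\<in>UNIV. X_inv a ^ Suc (\<alpha> $ a))"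
    by (simp add: chi_star_def chi_def prod.distrib)
  also have "\<dots> = nl_monom (\<Sum>a\<in>UNIV. axis a (Suc (\<alpha> $ a)))"
    by (simp only: X_inv_power nl_monom_sum)
  also have "(\<Sum>a\<in>UNIV. axis a (Suc (\<alpha> $ a))) = (\<chi> a. Suc (\<alpha> $ a))"
    by (simp add: Finite_Cartesian_Product.vec_eq_iff axis_def)
  finally show ?thesis .
qed

text \<open>Each power of x occurs in at most one entry of \<open>chi_star\<close>, so a coefficient
  of the product is a single entry of \<open>A\<close> or 0, even when rows of \<open>A\<close> are
  full. Identities between semi-infinite matrices thus pass to series without any interchange of
  infinite sums.\<close>

lemma nl_coeff_simat_apply_chi_star:
  "nl_coeff (simat_apply A chi_star \<alpha>) \<delta>
     = (if \<forall>a. 0 < \<delta> $ a then A \<alpha> (\<chi> a. \<delta> $ a - 1) else 0)"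
proof -
  define P where "P \<longleftrightarrow> (\<forall>a. 0 < \<delta> $ a)"
  \<comment> \<open>Subtraction on naturals truncates at 0, so the exponent shift is inverted only
    where \<open>P\<close> holds.\<close>
  have eq: "\<delta> = (\<chi> a. Suc (\<gamma> $ a)) \<longleftrightarrow> P \<and> \<gamma> = (\<chi> a. \<delta> $ a - 1)" for \<gamma>
    by (auto simp: P_def Finite_Cartesian_Product.vec_eq_iff)
  have "nl_coeff (simat_apply A chi_star \<alpha>) \<delta>
      = Sum_any (\<lambda>\<gamma>. if P \<and> \<gamma> = (\<chi> a. \<delta> $ a - 1) then A \<alpha> \<gamma> else 0)"
    unfolding simat_apply_def formal_sum_def nl_coeff_Neg_Laurent
    by (rule Sum_any.cong) (simp add: chi_star_monom nl_monom_def eq)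
  also have "\<dots> = (\<Sum>\<gamma>\<in>{\<chi> a. \<delta> $ a - 1}.
      if P \<and> \<gamma> = (\<chi> a. \<delta> $ a - 1) then A \<alpha> \<gamma> else 0)"
    by (rule Sum_any.expand_superset) (auto split: if_splits)
  finally show ?thesis by (simp add: P_def)
qed

section \<open>Block lower triangular semi-infinite matrices\<close>

text \<open>Phrased by degree on entries rather than through \<open>block\<close>, which keeps list
  positions out of the algebra of semi-infinite matrices.\<close>

definition lower_triangular :: "'n::finite simat \<Rightarrow> bool" where
  "lower_triangular A \<longleftrightarrow> (\<forall>\<alpha> \<beta>. mi_size \<alpha> < mi_size \<beta> \<longrightarrow> A \<alpha> \<beta> = 0)"

definition unit_lower_triangular :: "'n::finite simat \<Rightarrow> bool" where
  "unit_lower_triangular A \<longleftrightarrow> lower_triangular A \<and>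
     (\<forall>\<alpha> \<beta>. mi_size \<alpha> = mi_size \<beta> \<longrightarrow> A \<alpha> \<beta> = simat_one \<alpha> \<beta>)"

lemma finite_mi_size_le: "finite {\<gamma> :: 'n::finite multi_index. mi_size \<gamma> \<le> k}"
proof -
  have "{\<gamma> :: 'n multi_index. mi_size \<gamma> \<le> k} = (\<Union>j\<le>k. {\<gamma>. mi_size \<gamma> = j})" by auto
  then show ?thesis by (simp add: finite_mi_size)
qed

lemma finite_mi_size_less: "finite {\<gamma> :: 'n::finite multi_index. mi_size \<gamma> < k}"
  by (rule finite_subset[OF _ finite_mi_size_le[of k]]) auto

lemma lower_triangularD: "lower_triangular A \<Longrightarrow> mi_size \<alpha> < mi_size \<beta> \<Longrightarrow> A \<alpha> \<beta> = 0"
  by (simp add: lower_triangular_def)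

text \<open>Row \<alpha> of \<open>A\<close> is supported on finitely many multi-indices, so the
  product is a finite sum for arbitrary \<open>B\<close>.\<close>

lemma simat_mult_lower:
  assumes "lower_triangular A"
  shows "(A **\<^sub>s B) \<alpha> \<beta> = (\<Sum>\<gamma> | mi_size \<gamma> \<le> mi_size \<alpha>. A \<alpha> \<gamma> * B \<gamma> \<beta>)"
  unfolding simat_mult_def
  by (rule Sum_any.expand_superset)
    (use lower_triangularD[OF assms] in \<open>auto simp: finite_mi_size_le intro: leI\<close>)

lemma lower_triangular_mult:
  assumes "lower_triangular A" "lower_triangular B"
  shows "lower_triangular (A **\<^sub>s B)"
  unfolding lower_triangular_def simat_mult_lower[OF assms(1)]
  using lower_triangularD[OF assms(2)] by (auto intro!: sum.neutral)

text \<open>Triangularity of the two left factors makes all sums finite, hence \<open>C\<close> may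
  be arbitrary: later an upper triangular factor or an unknown inverse.\<close>

lemma simat_mult_assoc:
  assumes A: "lower_triangular A" and B: "lower_triangular B"
  shows "(A **\<^sub>s B) **\<^sub>s C = A **\<^sub>s (B **\<^sub>s C)"
proof (intro ext)
  fix \<alpha> \<beta>
  let ?L = "\<lambda>k. {\<gamma>. mi_size \<gamma> \<le> k}"
  have "((A **\<^sub>s B) **\<^sub>s C) \<alpha> \<beta>
      = (\<Sum>\<gamma>\<in>?L (mi_size \<alpha>). \<Sum>\<delta>\<in>?L (mi_size \<alpha>). A \<alpha> \<delta> * B \<delta> \<gamma> * C \<gamma> \<beta>)"
    by (simp add: simat_mult_lower lower_triangular_mult A B sum_distrib_right)
  also have "\<dots> = (\<Sum>\<delta>\<in>?L (mi_size \<alpha>). \<Sum>\<gamma>\<in>?L (mi_size \<alpha>). A \<alpha> \<delta> * B \<delta> \<gamma> * C \<gamma> \<beta>)"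
    by (rule sum.swap)
  also have "\<dots> = (\<Sum>\<delta>\<in>?L (mi_size \<alpha>). \<Sum>\<gamma>\<in>?L (mi_size \<delta>). A \<alpha> \<delta> * B \<delta> \<gamma> * C \<gamma> \<beta>)"
    by (intro sum.cong refl sum.mono_neutral_right)
      (auto simp: finite_mi_size_le lower_triangularD[OF B])
  also have "\<dots> = (A **\<^sub>s (B **\<^sub>s C)) \<alpha> \<beta>"
    by (simp add: simat_mult_lower A B sum_distrib_left mult.assoc)
  finally show "((A **\<^sub>s B) **\<^sub>s C) \<alpha> \<beta> = (A **\<^sub>s (B **\<^sub>s C)) \<alpha> \<beta>" .
qed

lemma simat_one_mult [simp]: "simat_one **\<^sub>s A = A"
proof (intro ext)
  fix \<alpha> \<beta>
  show "(simat_one **\<^sub>s A) \<alpha> \<beta> = A \<alpha> \<beta>"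
    unfolding simat_mult_def
    by (subst Sum_any.expand_superset[of "{\<alpha>}"]) (auto simp: simat_one_def)
qed

lemma simat_mult_one:
  assumes "lower_triangular A"
  shows "A **\<^sub>s simat_one = A"
proof (intro ext)
  fix \<alpha> \<beta>
  show "(A **\<^sub>s simat_one) \<alpha> \<beta> = A \<alpha> \<beta>"
    unfolding simat_mult_def
    by (subst Sum_any.expand_superset[of "{\<beta>}"]) (auto simp: simat_one_def)
qed

text \<open>The diagonal block is the identity, so among the \<gamma> of the size of \<alpha> only
  \<alpha> itself contributes.\<close>

lemma unit_lower_mult:
  assumes "unit_lower_triangular A"
  shows "(A **\<^sub>s B) \<alpha> \<beta> = B \<alpha> \<beta> + (\<Sum>\<gamma> | mi_size \<gamma> < mi_size \<alpha>. A \<alpha> \<gamma> * B \<gamma> \<beta>)"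
proof -
  have A: "lower_triangular A" "\<And>\<gamma>. mi_size \<gamma> = mi_size \<alpha> \<Longrightarrow> A \<alpha> \<gamma> = simat_one \<alpha> \<gamma>"
    using assms by (auto simp: unit_lower_triangular_def)
  have "(A **\<^sub>s B) \<alpha> \<beta> = (\<Sum>\<gamma>\<in>insert \<alpha> {\<gamma>. mi_size \<gamma> < mi_size \<alpha>}. A \<alpha> \<gamma> * B \<gamma> \<beta>)"
    unfolding simat_mult_lower[OF A(1)]
    by (rule sum.mono_neutral_right) (auto simp: finite_mi_size_le simat_one_def A(2))
  also have "\<dots> = B \<alpha> \<beta> + (\<Sum>\<gamma> | mi_size \<gamma> < mi_size \<alpha>. A \<alpha> \<gamma> * B \<gamma> \<beta>)"
    by (subst sum.insert) (auto simp: finite_mi_size_less A(2) simat_one_def)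
  finally show ?thesis .
qed

text \<open>Forward substitution, row block by row block, for the right inverse.\<close>

function forward_inv :: "'n::finite simat \<Rightarrow> 'n multi_index \<Rightarrow> 'n multi_index \<Rightarrow> real" where
  "forward_inv A \<alpha> \<beta> =
     simat_one \<alpha> \<beta> - (\<Sum>\<gamma> | mi_size \<gamma> < mi_size \<alpha>. A \<alpha> \<gamma> * forward_inv A \<gamma> \<beta>)"
  by pat_completeness auto
termination by (relation "Wellfounded.measure (\<lambda>(A, \<alpha>, \<beta>). mi_size \<alpha>)") auto

declare forward_inv.simps [simp del]

text \<open>By \<open>unit_lower_mult\<close>, the equation for a right inverse is the defining
  recursion.\<close>

lemma forward_inv_right:
  assumes "unit_lower_triangular A"
  shows "A **\<^sub>s forward_inv A = simat_one"
proof (intro ext)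
  fix \<alpha> \<beta>
  show "(A **\<^sub>s forward_inv A) \<alpha> \<beta> = simat_one \<alpha> \<beta>"
    unfolding unit_lower_mult[OF assms] by (subst forward_inv.simps) simp
qed

lemma lower_triangular_forward_inv: "lower_triangular (forward_inv A)"
proof -
  have "mi_size \<alpha> < mi_size \<beta> \<Longrightarrow> forward_inv A \<alpha> \<beta> = 0" for \<alpha> \<beta>
  proof (induction "mi_size \<alpha>" arbitrary: \<alpha> rule: less_induct)
    case less
    then show ?case
      by (subst forward_inv.simps) (auto simp: simat_one_def intro!: sum.neutral)
  qed
  then show ?thesis by (simp add: lower_triangular_def)
qed

lemma unit_lower_triangular_forward_inv: "unit_lower_triangular (forward_inv A)"
  unfolding unit_lower_triangular_def
proof (intro conjI allI impI lower_triangular_forward_inv)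
  fix \<alpha> \<beta> :: "'a multi_index" assume "mi_size \<alpha> = mi_size \<beta>"
  then show "forward_inv A \<alpha> \<beta> = simat_one \<alpha> \<beta>"
    by (subst forward_inv.simps)
      (auto intro!: sum.neutral simp: lower_triangularD[OF lower_triangular_forward_inv])
qed

text \<open>As in a group: the right inverse of \<open>A\<close> has a right inverse itself, and
  associativity identifies the latter with \<open>A\<close>.\<close>

lemma forward_inv_left:
  assumes "unit_lower_triangular A"
  shows "forward_inv A **\<^sub>s A = simat_one"
proof -
  let ?B = "forward_inv A"
  have A: "lower_triangular A" using assms by (simp add: unit_lower_triangular_def)
  have "A = A **\<^sub>s (?B **\<^sub>s forward_inv ?B)"
    by (simp add: forward_inv_right unit_lower_triangular_forward_inv simat_mult_one A)
  also have "\<dots> = (A **\<^sub>s ?B) **\<^sub>s forward_inv ?B"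
    by (simp add: simat_mult_assoc A lower_triangular_forward_inv)
  also have "\<dots> = forward_inv ?B" by (simp add: forward_inv_right assms)
  finally show ?thesis
    using forward_inv_right[OF unit_lower_triangular_forward_inv] by metis
qed

text \<open>The description in \<open>simat_inv\<close> ranges over all matrices, triangular or not.
  Uniqueness is the usual cancellation, with the competitor in the unrestricted third place of
  \<open>simat_mult_assoc\<close>.\<close>

lemma simat_inv_unit_lower:
  assumes "unit_lower_triangular A"
  shows "simat_inv A = forward_inv A"
  unfolding simat_inv_def
proof (rule the_equality)
  show "A **\<^sub>s forward_inv A = simat_one \<and> forward_inv A **\<^sub>s A = simat_one"
    using assms by (simp add: forward_inv_right forward_inv_left)
next
  fix B assume B: "A **\<^sub>s B = simat_one \<and> B **\<^sub>s A = simat_one"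
  have A: "lower_triangular A" using assms by (simp add: unit_lower_triangular_def)
  have "B = (forward_inv A **\<^sub>s A) **\<^sub>s B" by (simp add: forward_inv_left assms)
  also have "\<dots> = forward_inv A **\<^sub>s (A **\<^sub>s B)"
    by (simp add: simat_mult_assoc A lower_triangular_forward_inv)
  also have "\<dots> = forward_inv A"
    by (simp add: B simat_mult_one lower_triangular_forward_inv)
  finally show "B = forward_inv A" .
qed

section \<open>Matrices indexed by lists\<close>

text \<open>Blocks, columns and truncations all have this shape, and bordering becomes concatenation
  of index lists, so no offsets need computing.\<close>

definition list_mat :: "('a \<Rightarrow> 'b \<Rightarrow> 'c) \<Rightarrow> 'a list \<Rightarrow> 'b list \<Rightarrow> 'c mat" where
  "list_mat f xs ys = Matrix.mat (length xs) (length ys) (\<lambda>(i, j). f (xs ! i) (ys ! j))"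

lemma dim_list_mat [simp]:
  "dim_row (list_mat f xs ys) = length xs" "dim_col (list_mat f xs ys) = length ys"
  by (auto simp: list_mat_def)

lemma list_mat_carrier [simp]: "list_mat f xs ys \<in> carrier_mat (length xs) (length ys)"
  by (rule carrier_matI) auto

lemma list_mat_cong:
  "(\<And>x y. x \<in> set xs \<Longrightarrow> y \<in> set ys \<Longrightarrow> f x y = g x y) \<Longrightarrow> list_mat f xs ys = list_mat g xs ys"
  by (auto simp: list_mat_def intro!: cong_mat)

lemma list_mat_eqD:
  assumes "list_mat f xs ys = list_mat g xs ys" "x \<in> set xs" "y \<in> set ys"
  shows "f x y = g x y"
proof -
  obtain i j where "i < length xs" "x = xs ! i" "j < length ys" "y = ys ! j"
    using assms(2,3) by (auto simp: in_set_conv_nth)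
  then show ?thesis
    using arg_cong[OF assms(1), of "\<lambda>M. M $$ (i, j)"] by (simp add: list_mat_def)
qed

lemma append_cols_list_mat:
  "append_cols (list_mat f xs ys) (list_mat f xs zs) = list_mat f xs (ys @ zs)"
  unfolding append_cols_def
  by (rule eq_matI) (auto simp: list_mat_def nth_append)

text \<open>The 0 x 0 matrix ending the fold need not match the rows of \<open>A\<close>, but
  \<open>four_block_mat\<close> takes its dimensions from the diagonal blocks.\<close>

lemma append_cols_empty: "append_cols A (0\<^sub>m 0 0) = A"
  unfolding append_cols_def by (rule eq_matI) auto

lemma append_rows_list_mat:
  "append_rows (list_mat f xs zs) (list_mat f ys zs) = list_mat f (xs @ ys) zs"
  unfolding append_rows_def
  by (rule eq_matI) (auto simp: list_mat_def nth_append)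

lemma append_rows_empty: "append_rows A (0\<^sub>m 0 0) = A"
  unfolding append_rows_def by (rule eq_matI) auto

text \<open>The singleton list is the base case: for empty \<open>js\<close> the fold is 0 x 0,
  whatever the length of \<open>xs\<close>.\<close>

lemma foldr_append_cols_list_mat:
  "js \<noteq> [] \<Longrightarrow> foldr append_cols (map (\<lambda>j. list_mat f xs (b j)) js) (0\<^sub>m 0 0)
     = list_mat f xs (concat (map b js))"
  by (induction js rule: induct_list012) (auto simp: append_cols_empty append_cols_list_mat)

lemma foldr_append_rows_list_mat:
  "is \<noteq> [] \<Longrightarrow> foldr append_rows (map (\<lambda>i. list_mat f (a i) ys) is) (0\<^sub>m 0 0)
     = list_mat f (concat (map a is)) ys"
  by (induction "is" rule: induct_list012) (auto simp: append_rows_empty append_rows_list_mat)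

lemma block_mat_list_mat:
  assumes "is \<noteq> []" "js \<noteq> []"
  shows "block_mat (map (\<lambda>i. map (\<lambda>j. list_mat f (a i) (b j)) js) is)
           = list_mat f (concat (map a is)) (concat (map b js))"
  using assms
  by (simp add: block_mat_def o_def foldr_append_cols_list_mat foldr_append_rows_list_mat)

text \<open>Distinctness turns the scalar product over positions into a sum over the set of middle
  indices.\<close>

lemma list_mat_mult:
  assumes "distinct ys"
  shows "list_mat f xs ys * list_mat g ys zs = list_mat (\<lambda>x z. \<Sum>y\<in>set ys. f x y * g y z) xs zs"
  by (rule eq_matI)
    (auto simp: list_mat_def scalar_prod_def sum.distinct_set_conv_list[OF assms] sum_list_sum_nth
      interv_sum_list_conv_sum_set_nat)

lemma list_mat_minus:
  "list_mat f xs ys - list_mat g xs ys = list_mat (\<lambda>x y. f x y - g x y) xs ys"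
  by (rule eq_matI) (auto simp: list_mat_def)

lemma map_mat_list_mat: "map_mat h (list_mat f xs ys) = list_mat (\<lambda>x y. h (f x y)) xs ys"
  by (rule eq_matI) (auto simp: list_mat_def)

section \<open>Schur complements\<close>

lemma mat_inv_eq:
  assumes A: "A \<in> carrier_mat n n" and B: "B \<in> carrier_mat n n"
    and AB: "A * B = 1\<^sub>m n" and BA: "B * A = 1\<^sub>m n"
  shows "mat_inv A = B"
  unfolding mat_inv_def
proof (rule the_equality)
  show "inverts_mat A B \<and> inverts_mat B A"
    using assms by (auto simp: inverts_mat_def)
next
  fix X assume X: "inverts_mat A X \<and> inverts_mat X A"
  then have AX: "A * X = 1\<^sub>m n" and XA: "X * A = 1\<^sub>m (dim_row X)"
    using A by (auto simp: inverts_mat_def)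
  \<comment> \<open>\<open>inverts_mat\<close> does not fix the shape of \<open>X\<close>; it is
    recovered from the column counts of both products.\<close>
  have "dim_col X = n" using arg_cong[OF AX, of dim_col] by simp
  moreover have "dim_row X = n" using arg_cong[OF XA, of dim_col] A by simp
  ultimately have Xc: "X \<in> carrier_mat n n" by auto
  have "X = (B * A) * X" using Xc BA by simp
  also have "\<dots> = B" using assoc_mult_mat[OF B A Xc] AX B by simp
  finally show "X = B" .
qed

text \<open>Once the lower left corner factors as \<open>Y * A\<close>, the inverse cancels and
  never has to be computed; \<open>Z\<close> certifies that \<open>mat_inv A\<close> is an
  inverse.\<close>

lemma SC_eq:
  assumes A: "A \<in> carrier_mat n n" and Z: "Z \<in> carrier_mat n n"
    and AZ: "A * Z = 1\<^sub>m n" and ZA: "Z * A = 1\<^sub>m n"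
    and Y: "Y \<in> carrier_mat m n"
  shows "SC A B (Y * A) E = E - Y * B"
proof -
  have "Y * A * Z = Y" using assoc_mult_mat[OF Y A Z] AZ Y by simp
  then show ?thesis by (simp add: SC_def mat_inv_eq[OF A Z AZ ZA])
qed

lemma comm_ring_hom_const: "comm_ring_hom (const :: real \<Rightarrow> 'n::finite neg_laurent)"
proof
  fix x y :: real
  show "const (x * y) = (const x * const y :: 'n neg_laurent)"
    by (rule neg_laurent_eqI) (simp, simp add: const_def)
qed (rule neg_laurent_eqI; simp add: const_def one_neg_laurent_def)+

text \<open>A nonzero series need not be a unit, so the inverse is formed over the reals and carried
  along the ring embedding \<open>const\<close>.\<close>

lemma const_mat_inverse:
  fixes A :: "real mat"
  assumes A: "A \<in> carrier_mat n n" and det: "Determinant.det A \<noteq> 0"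
  obtains Z :: "'n::finite neg_laurent mat"
    where "Z \<in> carrier_mat n n" "map_mat const A * Z = 1\<^sub>m n" "Z * map_mat const A = 1\<^sub>m n"
proof -
  interpret comm_ring_hom "const :: real \<Rightarrow> 'n neg_laurent" by (rule comm_ring_hom_const)
  from det_non_zero_imp_unit[OF A det, of undefined]
  obtain B where B: "B \<in> carrier_mat n n" "B * A = 1\<^sub>m n" "A * B = 1\<^sub>m n"
    by (auto simp: Units_def ring_mat_def)
  show ?thesis
  proof (rule that)
    show "mat_hom B \<in> carrier_mat n n" using B by simp
    show "mat_hom A * mat_hom B = 1\<^sub>m n"
      using mat_hom_mult[OF A B(1)] B(3) by (simp add: mat_hom_one)
    show "mat_hom B * mat_hom A = 1\<^sub>m n"
      using mat_hom_mult[OF B(1) A] B(2) by (simp add: mat_hom_one)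
  qed
qed

section \<open>The factorization and the second kind functions\<close>

lemma distinct_mi_list: "distinct (mi_list k :: 'n::{finite,linorder} multi_index list)"
proof -
  have "sorted_wrt (\<noteq>) (mi_list k :: 'n multi_index list)"
    by (rule sorted_wrt_mono_rel[OF _ mi_list_sorted]) (use mi_less_asym in blast)
  then show ?thesis by (simp add: distinct_conv_nth sorted_wrt_iff_nth_less) (metis linorder_neqE_nat)
qed

definition mi_below :: "nat \<Rightarrow> 'n::{finite,linorder} multi_index list" where
  "mi_below l = concat (map mi_list [0..<l])"

lemma set_mi_below: "set (mi_below l) = {\<alpha>. mi_size \<alpha> < l}"
  by (auto simp: mi_below_def set_mi_list)

lemma distinct_mi_below: "distinct (mi_below l :: 'n::{finite,linorder} multi_index list)"
proof (induction l)
  case 0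
  then show ?case by (simp add: mi_below_def)
next
  case (Suc l)
  have "mi_below (Suc l) = mi_below l @ (mi_list l :: 'n multi_index list)"
    by (simp add: mi_below_def)
  then show ?case using Suc by (auto simp: distinct_mi_list set_mi_below set_mi_list)
qed

lemma block_list_mat: "block A k l = list_mat A (mi_list k) (mi_list l)"
  by (simp add: block_def list_mat_def)

text \<open>The one-element index list \<open>[()]\<close> brings column vectors under the rules for
  \<open>list_mat\<close>.\<close>

lemma vblock_list_mat: "vblock v k = list_mat (\<lambda>\<alpha> _. v \<alpha>) (mi_list k) [()]"
  by (simp add: vblock_def list_mat_def)

lemma block_zeroD:
  fixes A :: "'n::{finite,linorder} simat"
  assumes "block A k l = 0\<^sub>m (dim_row (block A k l)) (dim_col (block A k l))"
    and "mi_size \<alpha> = k" "mi_size \<beta> = l"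
  shows "A \<alpha> \<beta> = 0"
proof -
  have "block A k l = list_mat (\<lambda>_ _. 0) (mi_list k :: 'n multi_index list) (mi_list l :: 'n multi_index list)"
    by (subst assms(1)) (auto simp: block_list_mat list_mat_def)
  then show ?thesis
    unfolding block_list_mat by (rule list_mat_eqD) (use assms(2,3) in \<open>auto simp: set_mi_list\<close>)
qed

text \<open>\<open>mi_list k\<close> has no repetitions, so equal positions and equal multi-indices
  are the same thing.\<close>

lemma block_oneD:
  fixes A :: "'n::{finite,linorder} simat"
  assumes "block A k k = 1\<^sub>m (dim_row (block A k k))"
    and "mi_size \<alpha> = k" "mi_size \<beta> = k"
  shows "A \<alpha> \<beta> = simat_one \<alpha> \<beta>"
proof -
  have "block A k k = list_mat simat_one (mi_list k :: 'n multi_index list) (mi_list k)"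
    by (subst assms(1), rule eq_matI)
      (auto simp: block_list_mat list_mat_def simat_one_def nth_eq_iff_index_eq distinct_mi_list)
  then show ?thesis
    unfolding block_list_mat by (rule list_mat_eqD) (use assms(2,3) in \<open>auto simp: set_mi_list\<close>)
qed

lemma block_unitriangular_imp_unit_lower:
  "block_unitriangular S \<Longrightarrow> unit_lower_triangular S"
  unfolding block_unitriangular_def unit_lower_triangular_def lower_triangular_def
  by (metis block_zeroD block_oneD)

lemma block_diagonalD: "block_diagonal H \<Longrightarrow> mi_size \<alpha> \<noteq> mi_size \<beta> \<Longrightarrow> H \<alpha> \<beta> = 0"
  unfolding block_diagonal_def by (metis block_zeroD)

lemma cholesky_upper_factor:
  assumes "cholesky G S H"
  defines "M \<equiv> H **\<^sub>s simat_transpose (simat_inv S)"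
  shows "S **\<^sub>s G = M" and "mi_size \<beta> < mi_size \<alpha> \<Longrightarrow> M \<alpha> \<beta> = 0"
proof -
  have S: "unit_lower_triangular S" and H: "block_diagonal H"
    and G: "G = simat_inv S **\<^sub>s H **\<^sub>s simat_transpose (simat_inv S)"
    using assms(1) by (auto simp: cholesky_def block_unitriangular_imp_unit_lower)
  have LS: "lower_triangular S" using S by (simp add: unit_lower_triangular_def)
  have LH: "lower_triangular H" using block_diagonalD[OF H] by (simp add: lower_triangular_def)
  have inv: "simat_inv S = forward_inv S" by (rule simat_inv_unit_lower[OF S])
  \<comment> \<open>The upper triangular factor stands last, where \<open>simat_mult_assoc\<close>
    allows any matrix.\<close>
  have "G = forward_inv S **\<^sub>s M"
    unfolding G M_def inv by (rule simat_mult_assoc[OF lower_triangular_forward_inv LH])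
  then have "S **\<^sub>s G = (S **\<^sub>s forward_inv S) **\<^sub>s M"
    by (simp add: simat_mult_assoc[OF LS lower_triangular_forward_inv])
  then show "S **\<^sub>s G = M" by (simp add: forward_inv_right[OF S])
  show "M \<alpha> \<beta> = 0" if "mi_size \<beta> < mi_size \<alpha>"
    unfolding M_def simat_mult_lower[OF LH] simat_transpose_def inv
  proof (intro sum.neutral ballI)
    fix \<gamma> :: "'a multi_index"
    \<comment> \<open>Either \<gamma> differs in size from \<alpha> and \<open>H\<close> vanishes,
      or \<gamma> is larger than \<beta> and the inverse of \<open>S\<close> vanishes.\<close>
    show "H \<alpha> \<gamma> * forward_inv S \<beta> \<gamma> = 0"
      using block_diagonalD[OF H, of \<alpha> \<gamma>] that
        lower_triangularD[OF lower_triangular_forward_inv, of \<beta> \<gamma>]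
      by (cases "mi_size \<alpha> = mi_size \<gamma>") auto
  qed
qed

text \<open>Compare coefficients of one monomial: if all its exponents are negative, this is a
  single entry of row \<alpha> in \<open>S G = M\<close>; otherwise both sides are 0.\<close>

lemma second_kind_expansion:
  assumes "cholesky (moment_matrix \<mu>) S H"
  shows "second_kind S H \<alpha>
           = Gamma_vec \<mu> \<alpha> + (\<Sum>\<beta> | mi_size \<beta> < mi_size \<alpha>. const (S \<alpha> \<beta>) * Gamma_vec \<mu> \<beta>)"
proof (rule neg_laurent_eqI)
  fix \<delta>
  have "unit_lower_triangular S"
    using assms by (auto simp: cholesky_def block_unitriangular_imp_unit_lower)
  note row = unit_lower_mult[OF this, of "moment_matrix \<mu>" \<alpha>]
  show "nl_coeff (second_kind S H \<alpha>) \<delta> = nl_coeff (Gamma_vec \<mu> \<alpha>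
      + (\<Sum>\<beta> | mi_size \<beta> < mi_size \<alpha>. const (S \<alpha> \<beta>) * Gamma_vec \<mu> \<beta>)) \<delta>"
    unfolding second_kind_def Gamma_vec_def nl_coeff_plus nl_coeff_sum nl_coeff_const_mult
      nl_coeff_simat_apply_chi_star cholesky_upper_factor(1)[OF assms, symmetric] row
    by (cases "\<forall>a. 0 < \<delta> $ a") (simp_all only: if_True if_False mult_zero_right
        sum.neutral_const add_0_right simp_thms)
qed

text \<open>Below the block diagonal \<open>M\<close> vanishes. The sign is kept inside the sum so
  that it reads as a matrix product with the negative of \<open>S\<close>.\<close>

lemma moment_matrix_row:
  assumes "cholesky (moment_matrix \<mu>) S H" and "mi_size \<beta> < mi_size \<alpha>"
  shows "moment_matrix \<mu> \<alpha> \<beta>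
           = (\<Sum>\<gamma> | mi_size \<gamma> < mi_size \<alpha>. - S \<alpha> \<gamma> * moment_matrix \<mu> \<gamma> \<beta>)"
proof -
  have S: "unit_lower_triangular S"
    using assms(1) by (auto simp: cholesky_def block_unitriangular_imp_unit_lower)
  have "(S **\<^sub>s moment_matrix \<mu>) \<alpha> \<beta> = 0"
    using cholesky_upper_factor[OF assms(1)] assms(2) by simp
  then show ?thesis by (simp add: unit_lower_mult[OF S] sum_negf)
qed

theorem proposition2p5p4:
  fixes \<Omega> :: "'n::{finite,linorder} point set"
    and \<mu> :: "'n point measure"
    and S H :: "'n simat"
    and l :: nat
  assumes "borel_measure_on \<Omega> \<mu>"
    and "finite_moments \<mu>"
    and "\<forall>k. Determinant.det (truncation (moment_matrix \<mu>) k) \<noteq> 0"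
    and "cholesky (moment_matrix \<mu>) S H"
    and "l \<ge> 1"
  shows "vblock (second_kind S H) l =
           SC (block_mat (map (\<lambda>i. map (G_block \<mu> i) [0..<l]) [0..<l]))
              (block_mat (map (\<lambda>i. [Gamma_block \<mu> i]) [0..<l]))
              (block_mat [map (G_block \<mu> l) [0..<l]])
              (Gamma_block \<mu> l)
       \<and> vblock (second_kind S H) l =
           last_quasidet (map (\<lambda>i. map (G_block \<mu> i) [0..<l] @ [Gamma_block \<mu> i]) [0..<Suc l])"
proof -
  let ?G = "moment_matrix \<mu>" and ?L = "mi_below l :: 'n multi_index list"
    and ?r = "mi_list l :: 'n multi_index list"
  interpret comm_ring_hom "const :: real \<Rightarrow> 'n neg_laurent" by (rule comm_ring_hom_const)
  define A where "A = list_mat (\<lambda>\<alpha> \<beta>. const (?G \<alpha> \<beta>) :: 'n neg_laurent) ?L ?L"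
  define B where "B = list_mat (\<lambda>\<alpha> _. Gamma_vec \<mu> \<alpha>) ?L [()]"
  \<comment> \<open>The factor required by \<open>SC_eq\<close>: the negated blocks of
    \<open>S\<close> in block row \<open>l\<close>, left of the diagonal.\<close>
  define Y where "Y = list_mat (\<lambda>\<alpha> \<beta>. const (- S \<alpha> \<beta>) :: 'n neg_laurent) ?r ?L"
  \<comment> \<open>For \<open>l = 0\<close> there would be no block rows and
    \<open>block_mat_list_mat\<close> could not be applied.\<close>
  have ne: "[0..<l] \<noteq> []" using assms(5) by simp
  have Gb: "G_block \<mu> i j = list_mat (\<lambda>\<alpha> \<beta>. const (?G \<alpha> \<beta>)) (mi_list i) (mi_list j)" for i j
    by (simp add: G_block_def block_list_mat map_mat_list_mat)
  have A: "block_mat (map (\<lambda>i. map (G_block \<mu> i) [0..<l]) [0..<l]) = A"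
    unfolding A_def mi_below_def Gb by (rule block_mat_list_mat[OF ne ne])
  have B: "block_mat (map (\<lambda>i. [Gamma_block \<mu> i]) [0..<l]) = B"
    using block_mat_list_mat[OF ne, of "[()]" "\<lambda>\<alpha> _. Gamma_vec \<mu> \<alpha>" mi_list "\<lambda>x. [x]"]
    by (simp add: B_def mi_below_def Gamma_block_def vblock_list_mat)
  have "truncation ?G l = list_mat ?G ?L ?L"
    unfolding truncation_def mi_below_def block_list_mat by (rule block_mat_list_mat[OF ne ne])
  then have det: "Determinant.det (list_mat ?G ?L ?L) \<noteq> 0"
    using assms(3) by metis
  have "A = map_mat const (list_mat ?G ?L ?L)" by (simp add: A_def map_mat_list_mat)
  with const_mat_inverse[OF list_mat_carrier det]
  obtain Z where Z: "Z \<in> carrier_mat (length ?L) (length ?L)"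
    "A * Z = 1\<^sub>m (length ?L)" "Z * A = 1\<^sub>m (length ?L)" by metis
  have "block_mat [map (G_block \<mu> l) [0..<l]]
      = list_mat (\<lambda>\<alpha> \<beta>. const (?G \<alpha> \<beta>)) ?r ?L"
    using block_mat_list_mat[OF _ ne, of "[l]" "\<lambda>\<alpha> \<beta>. const (?G \<alpha> \<beta>)" mi_list mi_list]
    by (simp add: mi_below_def Gb[abs_def])
  also have "\<dots> = Y * A"
    unfolding Y_def A_def list_mat_mult[OF distinct_mi_below]
  proof (rule list_mat_cong)
    fix \<alpha> \<beta> assume "\<alpha> \<in> set ?r" "\<beta> \<in> set ?L"
    then have "mi_size \<beta> < mi_size \<alpha>" "l = mi_size \<alpha>" by (auto simp: set_mi_list set_mi_below)
    then show "const (?G \<alpha> \<beta>) = (\<Sum>\<gamma>\<in>set ?L. const (- S \<alpha> \<gamma>) * const (?G \<gamma> \<beta>) :: 'n neg_laurent)"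
      by (simp only: moment_matrix_row[OF assms(4)] set_mi_below hom_sum hom_mult)
  qed
  finally have "SC A B (block_mat [map (G_block \<mu> l) [0..<l]]) (Gamma_block \<mu> l)
      = Gamma_block \<mu> l - Y * B"
    using SC_eq[OF _ Z, of Y "length ?r"] by (simp add: A_def Y_def)
  also have "\<dots> = vblock (second_kind S H) l"
    unfolding Gamma_block_def vblock_list_mat Y_def B_def list_mat_mult[OF distinct_mi_below]
      list_mat_minus
  proof (rule list_mat_cong)
    fix \<alpha> :: "'n multi_index" and y assume "\<alpha> \<in> set ?r"
    then have "l = mi_size \<alpha>" by (simp add: set_mi_list)
    then show "Gamma_vec \<mu> \<alpha> - (\<Sum>\<beta>\<in>set ?L. const (- S \<alpha> \<beta>) * Gamma_vec \<mu> \<beta>)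
        = second_kind S H \<alpha>"
      by (simp add: second_kind_expansion[OF assms(4)] set_mi_below hom_uminus sum_negf)
  qed
  finally have SC: "vblock (second_kind S H) l
      = SC A B (block_mat [map (G_block \<mu> l) [0..<l]]) (Gamma_block \<mu> l)" by simp
  \<comment> \<open>Cutting off the last block row and the last block column returns exactly the
    four corners used above.\<close>
  have "last_quasidet (map (\<lambda>i. map (G_block \<mu> i) [0..<l] @ [Gamma_block \<mu> i]) [0..<Suc l])
      = SC A B (block_mat [map (G_block \<mu> l) [0..<l]]) (Gamma_block \<mu> l)"
    by (simp add: last_quasidet_def butlast_append o_def A B)
  then show ?thesis using SC A B by simp
qed

end
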